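(* For a combinatorial auction with $m\ge2$ items and $n\ge2$ bidders with unit-demand valuations, there is no randomized mechanism that is universally obviously strategy-proof, satisfies individual rationality and no negative transfers, and gives an approximation better than $\frac{8}{7}$ to the optimal social welfare; i.e., every such mechanism has $\sup_v\mathrm{OPT}(v)/\mathbb{E}[W(v)]\ge 8/7$.
   Context: A valuation is unit-demand if there are $v_{ij}\ge0$ with $v_i(A)=\max_{j\in A}v_{ij}$. Each bidder's domain $V_i$ is the set of unit-demand valuations (publicly known), valuations private, utilities quasi-linear. A deterministic mechanism is a rooted tree: each internal node is assigned to one bidder, who sends one of the messages labeling the outgoing edges; each leaf is labeled with a feasible allocation (disjoint bundles) and a payment for each bidder. A behavior $B_i$ specifies a message at every node of bidder $i$; a profile $B$ determines a root-to-leaf path $\mathrm{Path}(B)$ with bundle $f_i(B)$ and payment $p_i(B)$ for $i$. A strategy $\mathcal S_i$ maps each $v_i\in V_i$ to a behavior; it is obviously dominant if for every $v_i\in V_i$, every node $u$ of $i$, every $B_{-i}$ and every profile $B'$ with $u\in\mathrm{Path}(\mathcal S_i(v_i),B_{-i})\cap\mathrm{Path}(B')$ and $B'_i$ sending at $u$ a message different from $\mathcal S_i(v_i)$'s, $v_i(f_i(\mathcal S_i(v_i),B_{-i}))-p_i(\mathcal S_i(v_i),B_{-i})\ge v_i(f_i(B'))-p_i(B')$. A randomized mechanism is a probability distribution over deterministic mechanisms each with strategies; it is universally OSP if every mechanism in its support is OSP. Individual rationality: in every mechanism of the support, for every profile in $\prod_iV_i$, following the strategies gives each bidder utility $\ge0$.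 No negative transfers: every payment at every leaf of every mechanism in the support is $\ge0$. $\mathbb{E}[W(v)]$ is the expected welfare when bidders follow their strategies on profile $v$; $\mathrm{OPT}(v)$ is the optimal welfare. *)

theory Defs
  imports "HOL-Probability.Probability"
begin

text \<open>Items are 0..<m, bidders are 0..<n. A unit-demand valuation is given by its item
values w j = v({j}) >= 0 (canonically w j = 0 for j >= m); the value of a bundle A
is max over j in A of w j (0 for the empty bundle).\<close>

definition ud_val :: "(nat \<Rightarrow> real) \<Rightarrow> nat set \<Rightarrow> real" where
  "ud_val w A = (if A = {} then 0 else Max (w ` A))"

definition unit_demand_dom :: "nat \<Rightarrow> (nat \<Rightarrow> real) set" where
  "unit_demand_dom m = {w. (\<forall>j. 0 \<le> w j) \<and> (\<forall>j. m \<le> j \<longrightarrow> w j = 0)}"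

definition profiles :: "nat \<Rightarrow> nat \<Rightarrow> (nat \<Rightarrow> nat \<Rightarrow> real) set" where
  "profiles n m = {v. \<forall>i<n. v i \<in> unit_demand_dom m}"

definition feasible_alloc :: "nat \<Rightarrow> nat \<Rightarrow> (nat \<Rightarrow> nat set) \<Rightarrow> bool" where
  "feasible_alloc n m A \<longleftrightarrow>
     (\<forall>i<n. A i \<subseteq> {..<m}) \<and> (\<forall>i<n. \<forall>k<n. i \<noteq> k \<longrightarrow> A i \<inter> A k = {})"

definition welfare_of :: "nat \<Rightarrow> (nat \<Rightarrow> nat \<Rightarrow> real) \<Rightarrow> (nat \<Rightarrow> nat set) \<Rightarrow> real" where
  "welfare_of n v A = (\<Sum>i<n. ud_val (v i) (A i))"

definition OPT :: "nat \<Rightarrow> nat \<Rightarrow> (nat \<Rightarrow> nat \<Rightarrow> real) \<Rightarrow> real" where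
  "OPT n m v = Sup {welfare_of n v A | A. feasible_alloc n m A}"

text \<open>A node is either a leaf labelled with an allocation (bundle per bidder) and payments,
or an internal node assigned to a bidder, with the set of admissible messages and the
child reached by each message. Nodes are identified by their history (message list).\<close>

datatype 'm mtree =
    Leaf "nat \<Rightarrow> nat set" "nat \<Rightarrow> real"
  | Node nat "'m set" "'m \<Rightarrow> 'm mtree"

type_synonym 'm behavior = "'m list \<Rightarrow> 'm"
type_synonym 'm profile_beh = "nat \<Rightarrow> 'm behavior"
type_synonym 'm strategies = "nat \<Rightarrow> (nat \<Rightarrow> real) \<Rightarrow> 'm behavior"

fun subtree :: "'m mtree \<Rightarrow> 'm list \<Rightarrow> 'm mtree option" where
  "subtree t [] = Some t"
| "subtree (Leaf a p) (x # h) = None"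
| "subtree (Node i M c) (x # h) = (if x \<in> M then subtree (c x) h else None)"

primrec run_aux :: "'m mtree \<Rightarrow> 'm profile_beh \<Rightarrow> 'm list \<Rightarrow> 'm list \<times> (nat \<Rightarrow> nat set) \<times> (nat \<Rightarrow> real)" where
  "run_aux (Leaf a p) B h = (h, a, p)"
| "run_aux (Node i M c) B h = run_aux (c (B i h)) B (h @ [B i h])"

definition run :: "'m mtree \<Rightarrow> 'm profile_beh \<Rightarrow> 'm list \<times> (nat \<Rightarrow> nat set) \<times> (nat \<Rightarrow> real)" where
  "run t B = run_aux t B []"

definition Path :: "'m mtree \<Rightarrow> 'm profile_beh \<Rightarrow> 'm list set" where
  "Path t B = {u. prefix u (fst (run t B))}"

definition alloc :: "'m mtree \<Rightarrow> 'm profile_beh \<Rightarrow> nat \<Rightarrow> nat set" where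
  "alloc t B = fst (snd (run t B))"

definition pay :: "'m mtree \<Rightarrow> 'm profile_beh \<Rightarrow> nat \<Rightarrow> real" where
  "pay t B = snd (snd (run t B))"

definition utility :: "'m mtree \<Rightarrow> (nat \<Rightarrow> real) \<Rightarrow> nat \<Rightarrow> 'm profile_beh \<Rightarrow> real" where
  "utility t w i B = ud_val w (alloc t B i) - pay t B i"

definition node_of :: "'m mtree \<Rightarrow> nat \<Rightarrow> 'm list \<Rightarrow> bool" where
  "node_of t i u \<longleftrightarrow> (\<exists>M c. subtree t u = Some (Node i M c))"

definition valid_behavior :: "'m mtree \<Rightarrow> nat \<Rightarrow> 'm behavior \<Rightarrow> bool" where
  "valid_behavior t i b \<longleftrightarrow> (\<forall>u M c. subtree t u = Some (Node i M c) \<longrightarrow> b u \<in> M)"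

definition valid_profile :: "'m mtree \<Rightarrow> 'm profile_beh \<Rightarrow> bool" where
  "valid_profile t B \<longleftrightarrow> (\<forall>i. valid_behavior t i (B i))"

definition wf_mech :: "nat \<Rightarrow> nat \<Rightarrow> 'm mtree \<Rightarrow> bool" where
  "wf_mech n m t \<longleftrightarrow>
     (\<forall>u i M c. subtree t u = Some (Node i M c) \<longrightarrow> i < n \<and> M \<noteq> {}) \<and>
     (\<forall>u a p. subtree t u = Some (Leaf a p) \<longrightarrow> feasible_alloc n m a)"

definition valid_strategies :: "nat \<Rightarrow> nat \<Rightarrow> 'm mtree \<Rightarrow> 'm strategies \<Rightarrow> bool" where
  "valid_strategies n m t S \<longleftrightarrow>
     (\<forall>i<n. \<forall>w\<in>unit_demand_dom m. valid_behavior t i (S i w))"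

definition OSP :: "nat \<Rightarrow> nat \<Rightarrow> 'm mtree \<Rightarrow> 'm strategies \<Rightarrow> bool" where
  "OSP n m t S \<longleftrightarrow>
     (\<forall>i<n. \<forall>w\<in>unit_demand_dom m. \<forall>u B B'.
        node_of t i u \<longrightarrow> valid_profile t B \<longrightarrow> valid_profile t B' \<longrightarrow>
        u \<in> Path t (B(i := S i w)) \<longrightarrow> u \<in> Path t B' \<longrightarrow>
        B' i u \<noteq> S i w u \<longrightarrow>
        utility t w i (B(i := S i w)) \<ge> utility t w i B')"

definition truthful_profile :: "'m strategies \<Rightarrow> (nat \<Rightarrow> nat \<Rightarrow> real) \<Rightarrow> 'm profile_beh" where
  "truthful_profile S v = (\<lambda>i. S i (v i))"

definition IR :: "nat \<Rightarrow> nat \<Rightarrow> 'm mtree \<Rightarrow> 'm strategies \<Rightarrow> bool" where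
  "IR n m t S \<longleftrightarrow>
     (\<forall>v\<in>profiles n m. \<forall>i<n. utility t (v i) i (truthful_profile S v) \<ge> 0)"

definition no_neg_transfers :: "nat \<Rightarrow> 'm mtree \<Rightarrow> bool" where
  "no_neg_transfers n t \<longleftrightarrow>
     (\<forall>u a p. subtree t u = Some (Leaf a p) \<longrightarrow> (\<forall>i<n. p i \<ge> 0))"

definition realized_welfare :: "nat \<Rightarrow> 'm mtree \<Rightarrow> 'm strategies \<Rightarrow> (nat \<Rightarrow> nat \<Rightarrow> real) \<Rightarrow> real" where
  "realized_welfare n t S v = welfare_of n v (alloc t (truthful_profile S v))"

text \<open>A randomized mechanism is a probability measure on pairs (tree, strategies).
It is a well-formed, universally OSP, IR, no-negative-transfer mechanism if almost every
mechanism in it (i.e. every mechanism of its support) is so, and the realized welfare is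
a random variable for each valuation profile (so that its expectation is defined).\<close>

definition good_random_mech :: "nat \<Rightarrow> nat \<Rightarrow> ('m mtree \<times> 'm strategies) measure \<Rightarrow> bool" where
  "good_random_mech n m D \<longleftrightarrow>
     prob_space D \<and>
     (AE x in D. wf_mech n m (fst x) \<and> valid_strategies n m (fst x) (snd x) \<and>
                 OSP n m (fst x) (snd x) \<and> IR n m (fst x) (snd x) \<and>
                 no_neg_transfers n (fst x)) \<and>
     (\<forall>v\<in>profiles n m. (\<lambda>x. realized_welfare n (fst x) (snd x) v) \<in> borel_measurable D)"

definition expected_welfare :: "nat \<Rightarrow> ('m mtree \<times> 'm strategies) measure \<Rightarrow> (nat \<Rightarrow> nat \<Rightarrow> real) \<Rightarrow> real" where
  "expected_welfare n D v = (\<integral>x. realized_welfare n (fst x) (snd x) v \<partial>D)"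

end

theory Submission
  imports Defs
begin

text \<open>
  By averaging (Yao's principle) it suffices to exhibit finitely many weighted profiles on which
  every deterministic OSP mechanism loses a 1/8 fraction of the total optimal welfare. With values
  written as (item 0, item 1), the types are \<open>q = (1,0)\<close>, \<open>q' = (0,1)\<close>, \<open>y = (2,0)\<close>,
  \<open>y' = (2,4)\<close>, \<open>Z = (L,0)\<close>, \<open>Z' = (0,L)\<close> for large \<open>L\<close>; the profiles \<open>(q,q')\<close>, \<open>(q',q)\<close> have
  weight \<open>L\<close>, and \<open>(y,Z)\<close>, \<open>(Z,y)\<close>, \<open>(y',Z')\<close>, \<open>(Z',y')\<close> have weight 1, which makes the total
  optimum about \<open>8 L\<close>. Consider the first node at which two of these types of the same bidder send
  different messages. If \<open>q\<close> and \<open>q'\<close> are served in \<open>(q,q')\<close> and \<open>(q',q)\<close>, they pay at most 1, and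
  obvious dominance at this node forces \<open>y\<close> to win item 0 against \<open>Z\<close>, or \<open>y'\<close> to win item 1
  against \<open>Z'\<close>. Whatever happens, about \<open>L\<close> units of weighted welfare are lost.
\<close>

section \<open>Welfare and optimum of instances with two active bidders and two items\<close>

definition two_item :: "real \<Rightarrow> real \<Rightarrow> nat \<Rightarrow> real" where
  "two_item a b = (\<lambda>j. if j = 0 then a else if j = 1 then b else 0)"

text \<open>For \<open>i\<close> in {0, 1} the opponent is \<open>1 - i\<close>. Naming the own type
  first lets one argument cover both bidders; zero valuations elsewhere embed the instance into any
  \<open>n\<close>.\<close>

definition two_bidder ::
  "nat \<Rightarrow> (nat \<Rightarrow> real) \<Rightarrow> (nat \<Rightarrow> real) \<Rightarrow> nat \<Rightarrow> nat \<Rightarrow> real" where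
  "two_bidder i w x = (\<lambda>k. if k = i then w else if k = 1 - i then x else (\<lambda>_. 0))"

lemma two_bidder_swap: "two_bidder 1 w x = two_bidder 0 x w"
  by (auto simp: two_bidder_def fun_eq_iff)

lemma two_item_dom: "\<lbrakk>2 \<le> m; 0 \<le> a; 0 \<le> b\<rbrakk> \<Longrightarrow> two_item a b \<in> unit_demand_dom m"
  by (auto simp: two_item_def unit_demand_dom_def)

lemma two_bidder_profile:
  "\<lbrakk>w \<in> unit_demand_dom m; x \<in> unit_demand_dom m\<rbrakk> \<Longrightarrow> two_bidder i w x \<in> profiles n m"
  by (auto simp: two_bidder_def profiles_def unit_demand_dom_def)

lemma ud_val_zero: "ud_val (\<lambda>_. 0) A = 0"
  by (auto simp: ud_val_def image_constant_conv)

lemma ud_val_two_item: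
  assumes "finite A" "0 \<le> a" "0 \<le> b"
  shows "ud_val (two_item a b) A = max (if 0 \<in> A then a else 0) (if 1 \<in> A then b else 0)"
proof (cases "A = {}")
  case False
  have "Max (two_item a b ` A) = max (if 0 \<in> A then a else 0) (if 1 \<in> A then b else 0)"
  proof (rule Max_eqI)
    show "finite (two_item a b ` A)" using assms by simp
    show "y \<le> max (if 0 \<in> A then a else 0) (if 1 \<in> A then b else 0)"
      if "y \<in> two_item a b ` A" for y
      using that assms by (auto simp: two_item_def)
    show "max (if 0 \<in> A then a else 0) (if 1 \<in> A then b else 0) \<in> two_item a b ` A"
    proof (cases "0 \<in> A \<or> 1 \<in> A")
      case True
      have "a = two_item a b 0" "b = two_item a b 1" by (auto simp: two_item_def)
      then show ?thesis using True assms
        by (smt (verit) imageI max_def)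
    next
      case none: False
      obtain j where "j \<in> A" using \<open>A \<noteq> {}\<close> by auto
      then have "j \<noteq> 0" "j \<noteq> 1" using none by metis+
      then have "two_item a b j = 0" by (simp add: two_item_def)
      then show ?thesis using none \<open>j \<in> A\<close> by (auto intro!: image_eqI[of _ _ j])
    qed
  qed
  with False show ?thesis by (simp add: ud_val_def)
qed (simp add: ud_val_def)

lemma welfare_two_bidder:
  assumes "2 \<le> n"
  shows "welfare_of n (two_bidder 0 w x) A = ud_val w (A 0) + ud_val x (A 1)"
proof -
  have "welfare_of n (two_bidder 0 w x) A
      = (\<Sum>k\<in>{0,1}. ud_val (two_bidder 0 w x k) (A k))"
    unfolding welfare_of_def
    by (rule sum.mono_neutral_right) (use assms in \<open>auto simp: two_bidder_def ud_val_zero\<close>)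
  then show ?thesis by (simp add: two_bidder_def)
qed

lemma feasible_allocD:
  assumes "feasible_alloc n m A" "2 \<le> n"
  shows "i < n \<Longrightarrow> finite (A i)" "\<not> (j \<in> A 0 \<and> j \<in> A 1)"
proof -
  show "finite (A i)" if "i < n"
    using assms that unfolding feasible_alloc_def by (meson finite_lessThan finite_subset)
  have "A 0 \<inter> A 1 = {}"
    using assms unfolding feasible_alloc_def by (metis One_nat_def Suc_1 Suc_le_lessD
      less_trans zero_less_Suc zero_neq_one)
  then show "\<not> (j \<in> A 0 \<and> j \<in> A 1)" by auto
qed

lemma welfare_two_item:
  assumes "2 \<le> n" "feasible_alloc n m A" "0 \<le> a" "0 \<le> b" "0 \<le> c" "0 \<le> d"
  shows "welfare_of n (two_bidder 0 (two_item a b) (two_item c d)) A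
    = max (if 0 \<in> A 0 then a else 0) (if 1 \<in> A 0 then b else 0)
    + max (if 0 \<in> A 1 then c else 0) (if 1 \<in> A 1 then d else 0)"
  using assms feasible_allocD(1)[OF assms(2,1)]
  by (simp add: welfare_two_bidder ud_val_two_item)

text \<open>A unit-demand bidder counts one item and no item counts twice, so one of the two
  matchings of bidders with items dominates.\<close>

lemma welfare_two_item_le:
  assumes "2 \<le> n" "feasible_alloc n m A" "0 \<le> a" "0 \<le> b" "0 \<le> c" "0 \<le> d"
  shows "welfare_of n (two_bidder 0 (two_item a b) (two_item c d)) A \<le> max (a + d) (b + c)"
  using assms feasible_allocD(2)[OF assms(2,1), of 0] feasible_allocD(2)[OF assms(2,1), of 1]
  by (auto simp: welfare_two_item)

text \<open>The two matchings attain the two terms of the maximum; the welfare bound keeps the set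
  under \<open>Sup\<close> bounded above.\<close>

lemma OPT_two_item_ge:
  assumes "2 \<le> n" "2 \<le> m" "0 \<le> a" "0 \<le> b" "0 \<le> c" "0 \<le> d"
  shows "OPT n m (two_bidder 0 (two_item a b) (two_item c d)) \<ge> max (a + d) (b + c)"
proof -
  define v where "v = two_bidder 0 (two_item a b) (two_item c d)"
  have bdd: "bdd_above {welfare_of n v A | A. feasible_alloc n m A}"
    using welfare_two_item_le[OF assms(1) _ assms(3-6)]
    by (intro bdd_aboveI[of _ "max (a + d) (b + c)"]) (auto simp: v_def)
  define A :: "nat \<Rightarrow> nat \<Rightarrow> nat set"
    where "A r = (\<lambda>i. if i = 0 then {r} else if i = 1 then {1 - r} else {})" for r
  have fe: "feasible_alloc n m (A 0)" "feasible_alloc n m (A 1)"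
    using assms by (auto simp: feasible_alloc_def A_def)
  have "a + d = welfare_of n v (A 0)" "b + c = welfare_of n v (A 1)"
    using fe assms by (simp_all add: v_def welfare_two_item) (simp_all add: A_def)
  then show ?thesis
    unfolding OPT_def v_def[symmetric] using fe
    by (auto intro!: cSup_upper bdd)
qed

section \<open>Runs in the message tree and the first separating node\<close>

lemma prefix_run_aux: "prefix h (fst (run_aux t B h))"
proof (induction t arbitrary: h)
  case (Node i M c)
  have "prefix (h @ [B i h]) (fst (run_aux (c (B i h)) B (h @ [B i h])))"
    by (rule Node) simp
  then show ?case by (auto dest: append_prefixD)
qed simp

lemma subtree_snoc:
  "\<lbrakk>subtree t h = Some (Node i M c); x \<in> M\<rbrakk> \<Longrightarrow> subtree t (h @ [x]) = Some (c x)"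
proof (induction t h rule: subtree.induct)
  case (3 i M c x h)
  then show ?case by (auto split: if_splits)
qed auto

text \<open>Descend the tree as long as the family agrees: \<open>h\<close> is a node that all its
  members reach. Validity keeps the common message admissible, so the child is again a subtree of
  \<open>r\<close>.\<close>

lemma first_separation_aux:
  assumes valid: "\<And>B. B \<in> \<B> \<Longrightarrow> valid_profile r B"
    and "subtree r h = Some t" "\<And>B. B \<in> \<B> \<Longrightarrow> run r B = run_aux t B h"
  shows "(\<exists>o'. \<forall>B\<in>\<B>. snd (run r B) = o') \<or>
    (\<exists>i u. node_of r i u \<and> (\<forall>B\<in>\<B>. u \<in> Path r B) \<and> (\<exists>B\<in>\<B>. \<exists>B'\<in>\<B>. B i u \<noteq> B' i u))"
  using assms(2,3)
proof (induction t arbitrary: h)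
  case (Leaf a p)
  then show ?case by auto
next
  case (Node i M c)
  show ?case
  proof (cases "\<exists>B\<in>\<B>. \<exists>B'\<in>\<B>. B i h \<noteq> B' i h")
    case True
    have "node_of r i h" using Node.prems(1) by (auto simp: node_of_def)
    moreover have "\<forall>B\<in>\<B>. h \<in> Path r B"
      using Node.prems(2) by (auto simp only: Path_def prefix_run_aux mem_Collect_eq)
    ultimately show ?thesis using True by blast
  next
    case False
    show ?thesis
    proof (cases "\<B> = {}")
      case nonempty: False
      then obtain B0 where B0: "B0 \<in> \<B>" by auto
      define x where "x = B0 i h"
      have x: "B i h = x" if "B \<in> \<B>" for B using False B0 that by (auto simp: x_def)
      have "x \<in> M"
        using valid[OF B0] Node.prems(1) by (auto simp: valid_profile_def valid_behavior_def x_def)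
      then have "subtree r (h @ [x]) = Some (c x)" using Node.prems(1) by (rule subtree_snoc[rotated])
      moreover have "run r B = run_aux (c x) B (h @ [x])" if "B \<in> \<B>" for B
        using Node.prems(2)[OF that] x[OF that] by simp
      ultimately show ?thesis by (intro Node.IH[of "c x"]) auto
    qed auto
  qed
qed

lemma first_separation:
  assumes "\<forall>B\<in>\<B>. valid_profile t B"
  obtains (const) o' where "\<And>B. B \<in> \<B> \<Longrightarrow> snd (run t B) = o'"
  | (separated) i u B B' where "node_of t i u" "\<And>B. B \<in> \<B> \<Longrightarrow> u \<in> Path t B"
      "B \<in> \<B>" "B' \<in> \<B>" "B i u \<noteq> B' i u"
  using first_separation_aux[of \<B> t "[]" t] assms by (auto simp: run_def)

lemma run_aux_leaf:
  assumes "valid_profile r B" "subtree r h = Some t"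
  shows "\<exists>u a p. subtree r u = Some (Leaf a p) \<and> snd (run_aux t B h) = (a, p)"
  using assms(2)
proof (induction t arbitrary: h)
  case (Node i M c)
  have "B i h \<in> M" using assms(1) Node.prems by (auto simp: valid_profile_def valid_behavior_def)
  then have "subtree r (h @ [B i h]) = Some (c (B i h))" using Node.prems by (rule subtree_snoc[rotated])
  from Node.IH[OF _ this] show ?case by simp
qed auto

lemma run_leaf:
  assumes "valid_profile t B"
  obtains u where "subtree t u = Some (Leaf (alloc t B) (pay t B))"
  using run_aux_leaf[OF assms, of "[]" t] by (auto simp: run_def alloc_def pay_def)

lemma truthful_profile_valid:
  assumes "wf_mech n m t" "valid_strategies n m t S" "v \<in> profiles n m"
  shows "valid_profile t (truthful_profile S v)"
  unfolding valid_profile_def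
proof
  fix i
  show "valid_behavior t i (truthful_profile S v i)"
  proof (cases "i < n")
    case True
    then show ?thesis using assms by (auto simp: valid_strategies_def truthful_profile_def profiles_def)
  next
    case False
    \<comment> \<open>In a well-formed tree no node belongs to such an \<open>i\<close>, so every
      behavior is valid for it.\<close>
    then show ?thesis using assms(1) unfolding wf_mech_def valid_behavior_def by blast
  qed
qed

section \<open>Truthful play of one deterministic mechanism\<close>

locale osp_mechanism =
  fixes n m :: nat and t :: "'m mtree" and S :: "'m strategies"
  assumes items: "2 \<le> m" and bidders: "2 \<le> n"
    and wf: "wf_mech n m t" and strat: "valid_strategies n m t S"
    and osp: "OSP n m t S" and ir: "IR n m t S" and nnt: "no_neg_transfers n t"
begin

abbreviation truth :: "(nat \<Rightarrow> nat \<Rightarrow> real) \<Rightarrow> 'm profile_beh" where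
  "truth v \<equiv> truthful_profile S v"

definition won :: "nat \<Rightarrow> (nat \<Rightarrow> real) \<Rightarrow> (nat \<Rightarrow> real) \<Rightarrow> nat set" where
  "won i w x = alloc t (truth (two_bidder i w x)) i"

definition paid :: "nat \<Rightarrow> (nat \<Rightarrow> real) \<Rightarrow> (nat \<Rightarrow> real) \<Rightarrow> real" where
  "paid i w x = pay t (truth (two_bidder i w x)) i"

lemma truth_valid: "v \<in> profiles n m \<Longrightarrow> valid_profile t (truth v)"
  using truthful_profile_valid wf strat by blast

lemma feasible: "v \<in> profiles n m \<Longrightarrow> feasible_alloc n m (alloc t (truth v))"
  using wf unfolding wf_mech_def by (metis run_leaf truth_valid)

lemma pay_nonneg: "v \<in> profiles n m \<Longrightarrow> i < n \<Longrightarrow> 0 \<le> pay t (truth v) i"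
  using nnt unfolding no_neg_transfers_def by (metis run_leaf truth_valid)

text \<open>The deviating profile in \<open>OSP\<close> is taken to be truthful for other types:
  bidder \<open>i\<close> imitates the type \<open>v' i\<close>, and the opponents may change as
  well.\<close>

lemma obvious_dominance:
  assumes "i < n" "v \<in> profiles n m" "v' \<in> profiles n m" "node_of t i u"
    "u \<in> Path t (truth v)" "u \<in> Path t (truth v')" "S i (v i) u \<noteq> S i (v' i) u"
  shows "utility t (v i) i (truth v) \<ge> utility t (v i) i (truth v')"
proof -
  have "(truth v)(i := S i (v i)) = truth v" by (auto simp: truthful_profile_def)
  moreover have "v i \<in> unit_demand_dom m" using assms by (auto simp: profiles_def)
  moreover have "truth v' i u \<noteq> S i (v i) u" using assms(7) by (simp add: truthful_profile_def)
  ultimately show ?thesis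
    using osp assms truth_valid unfolding OSP_def by metis
qed

section \<open>The six hard types at a separating node\<close>

context
  fixes L :: real
  assumes L: "6 \<le> L"
begin

abbreviation "q \<equiv> two_item 1 0"
abbreviation "q' \<equiv> two_item 0 1"
abbreviation "y \<equiv> two_item 2 0"
abbreviation "y' \<equiv> two_item 2 4"
abbreviation "Z \<equiv> two_item L 0"
abbreviation "Z' \<equiv> two_item 0 L"

definition hard_types :: "(nat \<Rightarrow> real) set" where
  "hard_types = {q, q', y, y', Z, Z'}"

lemma hard_types_dom: "w \<in> hard_types \<Longrightarrow> w \<in> unit_demand_dom m"
  using items L by (auto simp: hard_types_def intro!: two_item_dom)

lemma hard_profiles:
  "\<lbrakk>w \<in> hard_types; x \<in> hard_types\<rbrakk> \<Longrightarrow> two_bidder i w x \<in> profiles n m"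
  by (intro two_bidder_profile hard_types_dom)

text \<open>Cheap service of \<open>q\<close> and \<open>q'\<close> makes imitation attractive to
  \<open>y\<close> and \<open>y'\<close>, who do badly against \<open>Z\<close> and
  \<open>Z'\<close>. Since obvious dominance sets the worst honest outcome against the best
  deviation, no two hard types can part at \<open>u\<close>, contrary to \<open>sep\<close>.\<close>

lemma no_harmless_separation:
  assumes i: "i < 2"
    and node: "node_of t i u"
    and path: "\<And>w x. \<lbrakk>w \<in> hard_types; x \<in> hard_types\<rbrakk> \<Longrightarrow> u \<in> Path t (truth (two_bidder i w x))"
    and sep: "w0 \<in> hard_types" "w1 \<in> hard_types" "S i w0 u \<noteq> S i w1 u"
    and served: "0 \<in> won i q q'" "1 \<in> won i q' q"
    and lose: "0 \<notin> won i y Z" "1 \<notin> won i y' Z'"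
  shows False
proof -
  have "i < n" using i bidders by simp
  \<comment> \<open>In \<open>U z w x\<close> the true valuation is \<open>z\<close>, the played
    type is \<open>w\<close> and the opponent has type \<open>x\<close>.\<close>
  define U where "U z w x = ud_val z (won i w x) - paid i w x" for z w x
  have U_eq: "U z w x = utility t z i (truth (two_bidder i w x))" for z w x
    by (simp add: U_def won_def paid_def utility_def)
  have own: "two_bidder i w x i = w" for w x by (simp add: two_bidder_def)
  have od: "U w w' x' \<le> U w w x" if "S i w u \<noteq> S i w' u"
    "w \<in> hard_types" "x \<in> hard_types" "w' \<in> hard_types" "x' \<in> hard_types" for w w' x x'
    unfolding U_eq
    using obvious_dominance[of i "two_bidder i w x" "two_bidder i w' x'" u]
      that path node hard_profiles \<open>i < n\<close> by (simp add: own)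
  have IR: "0 \<le> U w w x" if "w \<in> hard_types" "x \<in> hard_types" for w x
    using ir hard_profiles[OF that] \<open>i < n\<close> unfolding U_eq IR_def by (metis own)
  have fin: "finite (won i w x)" if "w \<in> hard_types" "x \<in> hard_types" for w x
    unfolding won_def using feasible_allocD(1)[OF feasible[OF hard_profiles[OF that]] bidders \<open>i < n\<close>] .
  have nonneg: "0 \<le> paid i w x" if "w \<in> hard_types" "x \<in> hard_types" for w x
    unfolding paid_def using pay_nonneg[OF hard_profiles[OF that] \<open>i < n\<close>] .
  have val: "ud_val (two_item a b) (won i w x)
      = max (if 0 \<in> won i w x then a else 0) (if 1 \<in> won i w x then b else 0)"
    if "w \<in> hard_types" "x \<in> hard_types" "0 \<le> a" "0 \<le> b" for w x a b
    using ud_val_two_item[OF fin] that by blast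
  have H: "q \<in> hard_types" "q' \<in> hard_types" "y \<in> hard_types" "y' \<in> hard_types"
    "Z \<in> hard_types" "Z' \<in> hard_types" by (auto simp: hard_types_def)
  note simps = U_def val H
  \<comment> \<open>A payment above the value 1 of the served item would violate individual
    rationality.\<close>
  have q_cheap: "paid i q q' \<le> 1" and q'_cheap: "paid i q' q \<le> 1"
    using IR[of q q'] IR[of q' q] served H by (auto simp: simps split: if_splits)
  \<comment> \<open>Without the contested item, \<open>y\<close> has no value left and
    \<open>y'\<close> at most the 2 of item 0.\<close>
  have y_low: "U y y Z \<le> 0" using lose nonneg[of y Z] by (simp add: simps)
  have y'_low: "U y' y' Z' \<le> 2" using lose nonneg[of y' Z'] by (simp add: simps)
  \<comment> \<open>Imitating \<open>q\<close> against \<open>q'\<close> would bring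
    \<open>y\<close> at least 2 - 1 = 1.\<close>
  have yq: "S i y u = S i q u"
  proof (rule ccontr)
    assume "S i y u \<noteq> S i q u"
    then have "U y q q' \<le> U y y Z" by (rule od) (auto simp: H)
    then show False using y_low q_cheap served by (simp add: simps)
  qed
  \<comment> \<open>The value 4 matters here: imitating \<open>q'\<close> brings \<open>y'\<close>
    at least 4 - 1 = 3, above its honest 2.\<close>
  have yq': "S i y' u = S i q' u"
  proof (rule ccontr)
    assume "S i y' u \<noteq> S i q' u"
    then have "U y' q' q \<le> U y' y' Z'" by (rule od) (auto simp: H)
    then show False using y'_low q'_cheap served by (simp add: simps)
  qed
  \<comment> \<open>If \<open>q\<close> and \<open>q'\<close> part, \<open>y'\<close> goes with
    \<open>q'\<close> and could get at least 2 - 1 by imitating \<open>q\<close>; so against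
    \<open>Z'\<close> it must win item 0 for at most 1. But then \<open>y\<close>, going with
    \<open>q\<close>, gains by imitating \<open>y'\<close>.\<close>
  have qq': "S i q u = S i q' u"
  proof (rule ccontr)
    assume ne: "S i q u \<noteq> S i q' u"
    then have "U y' q q' \<le> U y' y' Z'" by (intro od) (auto simp: H yq')
    then have "0 \<in> won i y' Z'" "paid i y' Z' \<le> 1"
      using q_cheap served lose nonneg[of y' Z'] by (auto simp: simps split: if_splits)
    moreover have "U y y' Z' \<le> U y y Z" using ne by (intro od) (auto simp: H yq' yq)
    ultimately show False using y_low by (simp add: simps split: if_splits)
  qed
  \<comment> \<open>A separated \<open>Z\<close> could get at least \<open>L - 1\<close> by
    imitating \<open>q\<close>, so facing \<open>q\<close> it wins item 0 for at most 1; then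
    \<open>y\<close> gains by imitating \<open>Z\<close>.\<close>
  have Zq: "S i Z u = S i q u"
  proof (rule ccontr)
    assume ne: "S i Z u \<noteq> S i q u"
    then have "U Z q q' \<le> U Z Z q" by (intro od) (auto simp: H)
    then have "0 \<in> won i Z q" "paid i Z q \<le> 1"
      using q_cheap served L nonneg[of Z q] by (auto simp: simps split: if_splits)
    moreover have "U y Z q \<le> U y y Z" using ne by (intro od) (auto simp: H yq)
    ultimately show False using y_low by (simp add: simps split: if_splits)
  qed
  \<comment> \<open>The same for item 1: imitating \<open>Z'\<close> would bring \<open>y'\<close>
    at least 4 - 1 = 3.\<close>
  have Zq': "S i Z' u = S i q' u"
  proof (rule ccontr)
    assume ne: "S i Z' u \<noteq> S i q' u"
    then have "U Z' q' q \<le> U Z' Z' q" by (intro od) (auto simp: H)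
    then have "1 \<in> won i Z' q" "paid i Z' q \<le> 1"
      using q'_cheap served L nonneg[of Z' q] by (auto simp: simps split: if_splits)
    moreover have "U y' Z' q \<le> U y' y' Z'" using ne by (intro od) (auto simp: H yq')
    ultimately show False using y'_low by (simp add: simps split: if_splits)
  qed
  show False using sep yq yq' qq' Zq Zq' unfolding hard_types_def by auto
qed

section \<open>Welfare lost by one deterministic mechanism\<close>

abbreviation W :: "(nat \<Rightarrow> real) \<Rightarrow> (nat \<Rightarrow> real) \<Rightarrow> real" where
  "W w x \<equiv> realized_welfare n t S (two_bidder 0 w x)"

lemma realized_welfare_two_item:
  assumes "two_item a b \<in> hard_types" "two_item c d \<in> hard_types" "0 \<le> a" "0 \<le> b" "0 \<le> c" "0 \<le> d"
  defines "w \<equiv> two_item a b" and "x \<equiv> two_item c d"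
  shows "W w x = max (if 0 \<in> won 0 w x then a else 0) (if 1 \<in> won 0 w x then b else 0)
    + max (if 0 \<in> won 1 x w then c else 0) (if 1 \<in> won 1 x w then d else 0)"
    "W w x \<le> max (a + d) (b + c)"
    "\<not> (j \<in> won 0 w x \<and> j \<in> won 1 x w)"
proof -
  have f: "feasible_alloc n m (alloc t (truth (two_bidder 0 w x)))"
    using assms by (intro feasible hard_profiles) auto
  have *: "won 1 x w = alloc t (truth (two_bidder 0 w x)) 1"
    unfolding won_def two_bidder_swap ..
  show "W w x = max (if 0 \<in> won 0 w x then a else 0) (if 1 \<in> won 0 w x then b else 0)
    + max (if 0 \<in> won 1 x w then c else 0) (if 1 \<in> won 1 x w then d else 0)"
    unfolding realized_welfare_def * unfolding won_def w_def x_def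
    by (rule welfare_two_item[OF bidders f[unfolded w_def x_def] assms(3-6)])
  show "W w x \<le> max (a + d) (b + c)"
    unfolding realized_welfare_def w_def x_def
    by (rule welfare_two_item_le[OF bidders f[unfolded w_def x_def] assms(3-6)])
  show "\<not> (j \<in> won 0 w x \<and> j \<in> won 1 x w)"
    using feasible_allocD(2)[OF f bidders] unfolding * unfolding won_def by blast
qed

text \<open>Each threshold is the most that is possible once \<open>q\<close> or \<open>q'\<close>
  goes unserved, or \<open>Z\<close> or \<open>Z'\<close> misses its item. Exceeding all six gives
  the hypotheses of \<open>no_harmless_separation\<close> for both bidders.\<close>

lemma some_profile_loses:
  "W q q' \<le> 1 \<or> W q' q \<le> 1 \<or> W y Z \<le> 2 \<or> W Z y \<le> 2 \<or> W y' Z' \<le> 4 \<or> W Z' y' \<le> 4"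
proof (rule ccontr)
  assume neg: "\<not> ?thesis"
  have H: "q \<in> hard_types" "q' \<in> hard_types" "y \<in> hard_types" "y' \<in> hard_types"
    "Z \<in> hard_types" "Z' \<in> hard_types" by (auto simp: hard_types_def)
  have A: "0 \<in> won 0 q q'" "1 \<in> won 1 q' q" "1 \<in> won 0 q' q" "0 \<in> won 1 q q'"
    using neg realized_welfare_two_item(1)[of 1 0 0 1] realized_welfare_two_item(1)[of 0 1 1 0] H
    by (auto split: if_splits)
  have B: "0 \<notin> won 0 y Z" "0 \<notin> won 1 y Z" "1 \<notin> won 0 y' Z'" "1 \<notin> won 1 y' Z'"
    using neg realized_welfare_two_item(1)[of 2 0 L 0] realized_welfare_two_item(1)[of L 0 2 0]
      realized_welfare_two_item(1)[of 2 4 0 L] realized_welfare_two_item(1)[of 0 L 2 4]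
      realized_welfare_two_item(3)[of 2 0 L 0 0] realized_welfare_two_item(3)[of L 0 2 0 0]
      realized_welfare_two_item(3)[of 2 4 0 L 1] realized_welfare_two_item(3)[of 0 L 2 4 1] H L
    by (auto split: if_splits)
  define \<B> where "\<B> = {truth (two_bidder 0 w x) | w x. w \<in> hard_types \<and> x \<in> hard_types}"
  have "\<forall>B\<in>\<B>. valid_profile t B"
    unfolding \<B>_def by (auto intro!: truth_valid hard_profiles)
  then show False
  proof (cases rule: first_separation)
    case (const o')
    \<comment> \<open>A constant outcome would give bidder 0 item 1 in the profile
      \<open>(q, q')\<close> too, where bidder 1 holds it.\<close>
    have "truth (two_bidder 0 q q') \<in> \<B>" "truth (two_bidder 0 q' q) \<in> \<B>"
      unfolding \<B>_def using H by blast+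
    then have "won 0 q q' = won 0 q' q"
      unfolding won_def alloc_def by (simp add: const)
    moreover have "\<not> (1 \<in> won 0 q q' \<and> 1 \<in> won 1 q' q)"
      by (rule realized_welfare_two_item(3)) (auto simp: H)
    ultimately show False using A by simp
  next
    case (separated i u B B')
    obtain w x w' x' where B_eq: "B = truth (two_bidder 0 w x)" "B' = truth (two_bidder 0 w' x')"
      and types: "w \<in> hard_types" "x \<in> hard_types" "w' \<in> hard_types" "x' \<in> hard_types"
      using separated(3,4) unfolding \<B>_def by blast
    have path0: "u \<in> Path t (truth (two_bidder 0 w x))"
      if "w \<in> hard_types" "x \<in> hard_types" for w x
      using that separated(2) unfolding \<B>_def by blast
    consider "i = 0" | "i = 1" | "i \<ge> 2" by linarith
    then show False
    proof cases
      case 1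
      show False
      proof (rule no_harmless_separation[of i u w w'])
        show "S i w u \<noteq> S i w' u"
          using separated(5) 1 by (simp add: B_eq truthful_profile_def two_bidder_def)
      qed (use 1 separated(1) path0 types A B in auto)
    next
      case 2
      show False
      proof (rule no_harmless_separation[of i u x x'])
        show "S i x u \<noteq> S i x' u"
          using separated(5) 2 by (simp add: B_eq truthful_profile_def two_bidder_def)
        show "u \<in> Path t (truth (two_bidder i w x))"
          if "w \<in> hard_types" "x \<in> hard_types" for w x
          using path0[OF that(2,1)] unfolding 2 two_bidder_swap .
      qed (use 2 separated(1) types A B in auto)
    next
      \<comment> \<open>Bidders from 2 on have the zero valuation throughout the family and cannot
        separate it.\<close>
      case 3
      then show False
        using separated(5) by (simp add: B_eq truthful_profile_def two_bidder_def)
    qed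
  qed
qed

text \<open>The optimum of the left side is \<open>8 * L + 4\<close>. Either the first pair loses 1
  at weight \<open>L\<close>, or one of the other profiles drops from \<open>L\<close> to 2 or from
  \<open>L + 2\<close> to 4, a loss of \<open>L - 2\<close>.\<close>

lemma weighted_welfare_le:
  "L * (W q q' + W q' q) + (W y Z + W Z y) + (W y' Z' + W Z' y') \<le> 7 * L + 6"
proof -
  have b: "W q q' \<le> 2" "W q' q \<le> 2" "W y Z \<le> L" "W Z y \<le> L" "W y' Z' \<le> L + 2" "W Z' y' \<le> L + 2"
    using realized_welfare_two_item(2)[of 1 0 0 1] realized_welfare_two_item(2)[of 0 1 1 0]
      realized_welfare_two_item(2)[of 2 0 L 0] realized_welfare_two_item(2)[of L 0 2 0]
      realized_welfare_two_item(2)[of 2 4 0 L] realized_welfare_two_item(2)[of 0 L 2 4] L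
    by (auto simp: hard_types_def max_def)
  show ?thesis
  proof (cases "W q q' + W q' q \<le> 3")
    case True
    then have "L * (W q q' + W q' q) \<le> L * 3" using L by (intro mult_left_mono) auto
    then show ?thesis using b by linarith
  next
    \<comment> \<open>With both terms at most 2, a sum above 3 rules out the first two alternatives
      of \<open>some_profile_loses\<close>.\<close>
    case False
    have "L * (W q q' + W q' q) \<le> L * 4" using L b by (intro mult_left_mono) auto
    then show ?thesis using b some_profile_loses False by argo
  qed
qed

end

end

section \<open>Averaging over the random mechanism\<close>

lemma realized_welfare_bounds:
  assumes "2 \<le> n" "2 \<le> m" "wf_mech n m t" "valid_strategies n m t S"
    "0 \<le> a" "0 \<le> b" "0 \<le> c" "0 \<le> d"
  defines "v \<equiv> two_bidder 0 (two_item a b) (two_item c d)"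
  shows "0 \<le> realized_welfare n t S v" "realized_welfare n t S v \<le> max (a + d) (b + c)"
proof -
  have "v \<in> profiles n m" unfolding v_def using assms by (intro two_bidder_profile two_item_dom) auto
  then have "feasible_alloc n m (alloc t (truthful_profile S v))"
    using assms(3) truthful_profile_valid[OF assms(3,4)] unfolding wf_mech_def by (metis run_leaf)
  from welfare_two_item[OF assms(1) this assms(5-8)] welfare_two_item_le[OF assms(1) this assms(5-8)]
  show "0 \<le> realized_welfare n t S v" "realized_welfare n t S v \<le> max (a + d) (b + c)"
    using assms(5-8) unfolding realized_welfare_def v_def by (auto simp: le_max_iff_disj)
qed

lemma realized_welfare_integrable:
  assumes "2 \<le> n" "2 \<le> m" "good_random_mech n m D" "0 \<le> a" "0 \<le> b" "0 \<le> c" "0 \<le> d"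
  defines "v \<equiv> two_bidder 0 (two_item a b) (two_item c d)"
  shows "integrable D (\<lambda>x. realized_welfare n (fst x) (snd x) v)"
proof -
  interpret prob_space D using assms(3) by (simp add: good_random_mech_def)
  have "v \<in> profiles n m" unfolding v_def using assms by (intro two_bidder_profile two_item_dom) auto
  then have "(\<lambda>x. realized_welfare n (fst x) (snd x) v) \<in> borel_measurable D"
    using assms(3) by (auto simp: good_random_mech_def)
  moreover have "AE x in D. norm (realized_welfare n (fst x) (snd x) v) \<le> max (a + d) (b + c)"
  proof -
    have "AE x in D. wf_mech n m (fst x) \<and> valid_strategies n m (fst x) (snd x)"
      using assms(3) by (auto simp: good_random_mech_def)
    then show ?thesis
    proof eventually_elim
      case (elim x)
      then show ?case
        using realized_welfare_bounds[of n m "fst x" "snd x" a b c d] assms(1,2,4-7)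
        unfolding v_def by simp
    qed
  qed
  ultimately show ?thesis by (intro integrable_const_bound)
qed

theorem theorem4p7:
  fixes n m :: nat and D :: "('m mtree \<times> 'm strategies) measure"
  assumes "m \<ge> 2" and "n \<ge> 2"
    and "good_random_mech n m D"
  shows "\<forall>c::real. c < 8/7 \<longrightarrow>
           (\<exists>v\<in>profiles n m. OPT n m v > c * expected_welfare n D v)"
proof (intro allI impI, rule ccontr)
  fix c :: real
  assume c: "c < 8/7" and "\<not> (\<exists>v\<in>profiles n m. OPT n m v > c * expected_welfare n D v)"
  then have le: "OPT n m v \<le> c * expected_welfare n D v" if "v \<in> profiles n m" for v
    using that by force
  interpret prob_space D using assms(3) by (simp add: good_random_mech_def)
  \<comment> \<open>Here \<open>8 - 7 * c\<close> is positive, and any \<open>L\<close> above the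
    quotient contradicts the final inequality; the 6 is what the hard types ask for.\<close>
  define L where "L = max 6 (6 * c / (8 - 7 * c) + 1)"
  have L: "6 \<le> L" by (simp add: L_def)
  define pr where "pr a b c d = two_bidder 0 (two_item a b) (two_item c d)" for a b c d
  define W where "W v x = realized_welfare n (fst x) (snd x) v"
    for v and x :: "'m mtree \<times> 'm strategies"
  define E where "E v = expected_welfare n D v" for v
  have E_eq: "E v = (\<integral>x. W v x \<partial>D)" for v by (simp add: E_def W_def expected_welfare_def)
  have int: "integrable D (W (pr a b c d))" if "0 \<le> a" "0 \<le> b" "0 \<le> c" "0 \<le> d" for a b c d
    unfolding W_def pr_def using realized_welfare_integrable assms that by blast
  have ints: "integrable D (W (pr 1 0 0 1))" "integrable D (W (pr 0 1 1 0))"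
    "integrable D (W (pr 2 0 L 0))" "integrable D (W (pr L 0 2 0))"
    "integrable D (W (pr 2 4 0 L))" "integrable D (W (pr 0 L 2 4))"
    using L by (auto intro!: int)
  have ge: "max (a + d) (b + c') \<le> c * E (pr a b c' d)"
    if "0 \<le> a" "0 \<le> b" "0 \<le> c'" "0 \<le> d" for a b c' d
  proof -
    have "pr a b c' d \<in> profiles n m"
      unfolding pr_def using that assms by (intro two_bidder_profile two_item_dom) auto
    then show ?thesis
      using le OPT_two_item_ge[of n m a b c' d] assms that unfolding E_def pr_def by force
  qed
  \<comment> \<open>Averaging step: the weighted welfare is bounded for almost every realized
    mechanism, then integrated.\<close>
  define T where "T x = L * (W (pr 1 0 0 1) x + W (pr 0 1 1 0) x)
    + (W (pr 2 0 L 0) x + W (pr L 0 2 0) x) + (W (pr 2 4 0 L) x + W (pr 0 L 2 4) x)" for x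
  have "AE x in D. T x \<le> 7 * L + 6"
  proof -
    have "AE x in D. osp_mechanism n m (fst x) (snd x)"
      using assms by (auto simp: good_random_mech_def osp_mechanism_def)
    then show ?thesis
      by eventually_elim
        (use osp_mechanism.weighted_welfare_le[OF _ L] in \<open>simp add: T_def W_def pr_def\<close>)
  qed
  moreover have "integrable D T"
    unfolding T_def
    by (intro Bochner_Integration.integrable_add integrable_mult_right ints)
  ultimately have T_le: "(\<integral>x. T x \<partial>D) \<le> 7 * L + 6"
    by (intro integral_le_const) auto
  have T_eq: "(\<integral>x. T x \<partial>D) = L * (E (pr 1 0 0 1) + E (pr 0 1 1 0))
    + (E (pr 2 0 L 0) + E (pr L 0 2 0)) + (E (pr 2 4 0 L) + E (pr 0 L 2 4))"
    unfolding T_def E_eq using ints by simp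
  \<comment> \<open>Positivity of \<open>c\<close>, used to scale the bound on the integral, follows
    from a positive optimum and a nonnegative expected welfare.\<close>
  have "2 \<le> c * E (pr 1 0 0 1)" using ge[of 1 0 0 1] by simp
  moreover have "0 \<le> E (pr 1 0 0 1)"
  proof -
    have "AE x in D. wf_mech n m (fst x) \<and> valid_strategies n m (fst x) (snd x)"
      using assms(3) by (auto simp: good_random_mech_def)
    then have "AE x in D. 0 \<le> W (pr 1 0 0 1) x"
      by eventually_elim (use assms in \<open>auto simp: W_def pr_def intro!: realized_welfare_bounds(1)[of n m]\<close>)
    then show ?thesis unfolding E_eq by (rule integral_nonneg_AE)
  qed
  ultimately have "0 < c" by (smt (verit) mult_nonpos_nonneg)
  have "2 + 2 \<le> c * E (pr 1 0 0 1) + c * E (pr 0 1 1 0)"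
    using ge[of 1 0 0 1] ge[of 0 1 1 0] by (intro add_mono) auto
  then have "L * 4 \<le> L * (c * E (pr 1 0 0 1) + c * E (pr 0 1 1 0))"
    using L by (intro mult_left_mono) auto
  moreover have "L \<le> c * E (pr 2 0 L 0)" "L \<le> c * E (pr L 0 2 0)"
    "L \<le> c * E (pr 2 4 0 L)" "L \<le> c * E (pr 0 L 2 4)"
    using ge[of 2 0 L 0] ge[of L 0 2 0] ge[of 2 4 0 L] ge[of 0 L 2 4] L by auto
  \<comment> \<open>The first pair contributes \<open>4 * L\<close> and each of the other four
    profiles at least \<open>L\<close>.\<close>
  ultimately have "8 * L \<le> c * (\<integral>x. T x \<partial>D)"
    unfolding T_eq by (simp add: algebra_simps)
  also have "\<dots> \<le> c * (7 * L + 6)" using T_le \<open>0 < c\<close> by (intro mult_left_mono) auto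
  finally have "L * (8 - 7 * c) \<le> 6 * c" by (simp add: algebra_simps)
  then have "L \<le> 6 * c / (8 - 7 * c)" using c by (simp add: pos_le_divide_eq)
  then show False by (simp add: L_def)
qed

end
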